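(* Let $N\ge 3$. In the three-colour hat guessing game on the cycle graph $C_N$, a winning strategy exists if and only if $N$ is divisible by $3$ or $N=4$.
   Context: Three-colour hat guessing game on $C_N$: players are indexed by $k\in\mathbb{Z}/N\mathbb{Z}$. For each $k$, $V_k$ is a three-element set (the possible hat colours of player $k$; one may take $V_k=\mathbb{Z}_3$). A strategy is a family $f=(f_k)_{k\in\mathbb{Z}/N}$ of functions $f_k:V_{k-1}\times V_{k+1}\to V_k$ (player $k$ guesses their own colour from the colours of players $k-1$ and $k+1$). The strategy $f$ is winning if there is no colouring $(s_k)_{k\in\mathbb{Z}/N}$ with $s_k\in V_k$ such that $s_k\neq f_k(s_{k-1},s_{k+1})$ for all $k\in\mathbb{Z}/N$, i.e. for every colouring at least one player guesses correctly; otherwise it is losing. *)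

theory Defs
  imports Main "HOL-Library.FuncSet"
begin

(* The players, i.e. the elements of Z/N, are represented by the residues 0, ..., N - 1. *)

definition players :: "nat \<Rightarrow> nat set" where
  "players N = {..<N}"

definition prev_player :: "nat \<Rightarrow> nat \<Rightarrow> nat" where
  "prev_player N k = (k + (N - 1)) mod N"

definition next_player :: "nat \<Rightarrow> nat \<Rightarrow> nat" where
  "next_player N k = (k + 1) mod N"

definition colourings :: "nat \<Rightarrow> (nat \<Rightarrow> 'c set) \<Rightarrow> (nat \<Rightarrow> 'c) set" where
  "colourings N V = (\<Pi> k\<in>players N. V k)"

(* The values of a strategy outside its domain (non-players, non-colours) are unconstrained;
   they do not affect whether it is winning. *)

definition strategies :: "nat \<Rightarrow> (nat \<Rightarrow> 'c set) \<Rightarrow> (nat \<Rightarrow> 'c \<times> 'c \<Rightarrow> 'c) set" where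
  "strategies N V =
     (\<Pi> k\<in>players N. (V (prev_player N k) \<times> V (next_player N k)) \<rightarrow> V k)"

definition winning :: "nat \<Rightarrow> (nat \<Rightarrow> 'c set) \<Rightarrow> (nat \<Rightarrow> 'c \<times> 'c \<Rightarrow> 'c) \<Rightarrow> bool" where
  "winning N V f \<longleftrightarrow>
     \<not> (\<exists>s\<in>colourings N V. \<forall>k\<in>players N.
          s k \<noteq> f k (s (prev_player N k), s (next_player N k)))"

end

theory Submission
  imports Defs "HOL-Library.Numeral_Type"
begin

text \<open>
  A colouring on which everybody is wrong is a closed walk of length \<open>N\<close> through the pairs
  \<open>(s k, s (k + 1))\<close>, where \<open>(x, y)\<close> at \<open>k\<close> may be followed by \<open>(y, z)\<close> if \<open>F (k + 1) x z \<noteq> y\<close>.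

  Necessity. Suppose there is no closed walk and \<open>N \<ge> 4\<close>. If a pair has three successors, the
  walks from it reach so many pairs that it can have only one predecessor, and dually. So
  out-degree plus in-degree is at most 4 everywhere; as it is 4 on average, it is exactly 4. A
  pair of out-degree 3 (``heavy'') has a unique predecessor, which is heavy again. Hence the heavy
  pairs form chains running around the cycle, and one can rename the colours so that each chain is
  constant up to a permutation (the holonomy) picked up after \<open>N\<close> steps. This permutation has no
  fixed point on the chains, so their number is 0, 2 or 3. If it is 0, every \<open>F k\<close> is a Latin
  square and the walks from any pair close up when \<open>N \<ge> 5\<close>. If it is 2 or 3, the strategy is known
  well enough to write down a closed walk, unless \<open>N = 4\<close> or \<open>3 dvd N\<close>, respectively.

  Sufficiency. The strategies come from the same normal forms: a common guessing function for all
  players, where the colours are changed by a permutation between the players \<open>N - 1\<close> and \<open>0\<close>. It is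
  \<open>x \<mapsto> x + 1\<close> on \<open>\<int>/3\<close> if \<open>3 dvd N\<close>, and a transposition if \<open>N = 4\<close>.
\<close>

subsection \<open>Counting on finite types\<close>

lemma exists_common_element:
  fixes A B :: "'b::finite set"
  assumes "CARD('b) < card A + card B"
  shows "\<exists>x. x \<in> A \<and> x \<in> B"
proof (rule ccontr)
  assume "\<not> ?thesis"
  then have "card (A \<union> B) = card A + card B" by (intro card_Un_disjoint) auto
  then show False using assms card_mono[of UNIV "A \<union> B"] by simp
qed

lemma card_neq: "card {y::'b::finite. y \<noteq> c} = CARD('b) - 1"
proof -
  have "{y. y \<noteq> c} = UNIV - {c}" by auto
  then show ?thesis by (simp add: card_Diff_singleton)
qed

text \<open>Domain and range of \<open>R\<close> have equal size, hence so do their complements, and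
  any bijection between the complements completes \<open>R\<close>.\<close>

lemma partial_injection_extends_to_bij:
  fixes R :: "'b::finite \<Rightarrow> 'b \<Rightarrow> bool"
  assumes "\<And>x y y'. R x y \<Longrightarrow> R x y' \<Longrightarrow> y = y'"
    and "\<And>x x' y. R x y \<Longrightarrow> R x' y \<Longrightarrow> x = x'"
  shows "\<exists>h. bij h \<and> (\<forall>x y. R x y \<longrightarrow> y = h x)"
proof -
  let ?X = "{x. \<exists>y. R x y}" and ?Y = "{y. \<exists>x. R x y}"
  define g where "g x = (THE y. R x y)" for x
  have g: "g x = y" if "R x y" for x y
    unfolding g_def using that assms(1) by blast
  have bg: "bij_betw g ?X ?Y"
    unfolding bij_betw_def inj_on_def using g assms(2) by (auto simp: image_iff)
  then have "card ?X = card ?Y" by (rule bij_betw_same_card)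
  then have "card (- ?X) = card (- ?Y)" by (simp add: Compl_eq_Diff_UNIV card_Diff_subset)
  then obtain g' where g': "bij_betw g' (- ?X) (- ?Y)"
    using finite_same_card_bij by (metis finite)
  let ?h = "\<lambda>x. if x \<in> ?X then g x else g' x"
  have "bij_betw ?h (?X \<union> - ?X) (?Y \<union> - ?Y)"
    by (rule bij_betw_disjoint_Un[OF bg g']) auto
  then have "bij ?h" by simp
  moreover have "y = ?h x" if "R x y" for x y using g[OF that] that by auto
  ultimately show ?thesis by blast
qed

lemma card_slices:
  fixes R :: "'b::finite \<times> 'b \<Rightarrow> bool"
  shows "card {p. R p} = (\<Sum>a\<in>UNIV. card {b. R (a, b)})"
    and "card {p. R p} = (\<Sum>b\<in>UNIV. card {a. R (a, b)})"
proof -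
  have "card {p. R p} = (\<Sum>p\<in>UNIV \<times> UNIV. of_bool (R p))" by simp
  also have "\<dots> = (\<Sum>a\<in>UNIV. \<Sum>b\<in>UNIV. of_bool (R (a, b)))"
    by (subst sum.cartesian_product) (intro sum.cong, auto)
  finally have *: "card {p. R p} = (\<Sum>a\<in>UNIV. \<Sum>b\<in>UNIV. of_bool (R (a, b)))" .
  then show "card {p. R p} = (\<Sum>a\<in>UNIV. card {b. R (a, b)})" by simp
  show "card {p. R p} = (\<Sum>b\<in>UNIV. card {a. R (a, b)})"
    unfolding * by (subst sum.swap) simp
qed

subsection \<open>Walks and degrees\<close>

text \<open>Players are unrolled to all integers with \<open>F\<close> of period \<open>N\<close>,
  so the neighbours of \<open>k\<close> are \<open>k - 1\<close> and \<open>k + 1\<close> without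
  reduction modulo \<open>N\<close>. The bound \<open>N \<ge> 4\<close> makes walks of length
  \<open>N - 2\<close> long enough for \<open>spread\<close>.\<close>

locale winning_cycle =
  fixes F :: "int \<Rightarrow> 'a::finite \<Rightarrow> 'a \<Rightarrow> 'a" and N :: nat
  assumes three_colours: "CARD('a) = 3"
    and N_ge: "N \<ge> 4"
    and periodic: "F (k + int N) = F k"
    and no_losing_colouring:
      "(\<And>k. s (k + int N) = s k) \<Longrightarrow> \<exists>k. s k = F k (s (k - 1)) (s (k + 1))"
begin

text \<open>The length \<open>n\<close> counts transitions: exactly the players
  \<open>k + 1\<close>, ..., \<open>k + n\<close> are required to guess wrongly.\<close>

definition walk :: "int \<Rightarrow> nat \<Rightarrow> 'a \<times> 'a \<Rightarrow> 'a \<times> 'a \<Rightarrow> bool" where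
  "walk k n p q \<longleftrightarrow> (\<exists>s. p = (s k, s (k + 1)) \<and> q = (s (k + int n), s (k + int n + 1)) \<and>
     (\<forall>j\<in>{k<..k + int n}. s j \<noteq> F j (s (j - 1)) (s (j + 1))))"

text \<open>\<open>out\<close> counts the successors of the pair \<open>(x, y)\<close> at positions
  \<open>k\<close>, \<open>k + 1\<close>, where player \<open>k + 1\<close> must be wrong;
  \<open>inn\<close> counts its predecessors, where player \<open>k\<close> must be wrong.\<close>

definition out :: "int \<Rightarrow> 'a \<Rightarrow> 'a \<Rightarrow> nat" where
  "out k x y = card {z. F (k + 1) x z \<noteq> y}"

definition inn :: "int \<Rightarrow> 'a \<Rightarrow> 'a \<Rightarrow> nat" where
  "inn k x y = card {w. F k w y \<noteq> x}"

lemma walk_0: "walk k 0 p p"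
  unfolding walk_def by (rule exI[of _ "\<lambda>j. if j = k then fst p else snd p"]) auto

lemma walk_Suc:
  assumes "walk k n p (x, y)" "F (k + int n + 1) x z \<noteq> y"
  shows "walk k (Suc n) p (y, z)"
proof -
  obtain s where s: "p = (s k, s (k + 1))" "x = s (k + int n)" "y = s (k + int n + 1)"
    "\<And>j. j \<in> {k<..k + int n} \<Longrightarrow> s j \<noteq> F j (s (j - 1)) (s (j + 1))"
    using assms(1) unfolding walk_def by auto
  let ?s = "s(k + int n + 2 := z)"
  have "?s j \<noteq> F j (?s (j - 1)) (?s (j + 1))" if "j \<in> {k<..k + int (Suc n)}" for j
  proof (cases "j = k + int n + 1")
    case True
    then show ?thesis using assms(2) s(2,3) by (simp add: algebra_simps)
  next
    case False
    then show ?thesis using s(4)[of j] that by auto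
  qed
  then show ?thesis unfolding walk_def
    by (intro exI[of _ ?s]) (use s(1-3) in \<open>auto simp: algebra_simps\<close>)
qed

text \<open>Repeating a closed walk with period \<open>N\<close> gives a periodic colouring on which
  every player is wrong.\<close>

lemma no_closed_walk: "\<not> walk k N p p"
proof
  assume "walk k N p p"
  then obtain s where s: "s k = s (k + int N)" "s (k + 1) = s (k + int N + 1)"
    "\<And>j. j \<in> {k<..k + int N} \<Longrightarrow> s j \<noteq> F j (s (j - 1)) (s (j + 1))"
    unfolding walk_def by auto
  define u where "u j = s (k + (j - k) mod int N)" for j
  have per: "u (j + int N) = u j" for j
    unfolding u_def by (simp add: add_diff_eq[symmetric] add.commute[of j] add.assoc)
  \<comment> \<open>The range goes up to \<open>k + N + 1\<close> because player
    \<open>k + N\<close> sees that position.\<close>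
  have u: "u j = s j" if "j \<in> {k..k + int N + 1}" for j
  proof -
    consider "j < k + int N" | "j = k + int N" | "j = k + int N + 1" using \<open>j \<in> _\<close> by force
    then show ?thesis
    proof cases
      case 1
      then show ?thesis using that by (simp add: u_def)
    next
      case 2
      then show ?thesis using s(1) by (simp add: u_def)
    next
      case 3
      then have "(j - k) mod int N = 1 mod int N" by (simp add: mod_add_self1)
      then show ?thesis using 3 s(2) N_ge by (simp add: u_def)
    qed
  qed
  have Fm: "F (j + int N * m) = F j" for j m
  proof (induction m rule: int_induct[of _ 0])
    case base
    then show ?case by simp
  next
    case (step1 i)
    then show ?case using periodic[of "j + int N * i"] by (simp add: algebra_simps)
  next
    case (step2 i)
    then show ?case using periodic[of "j + int N * (i - 1)"] by (simp add: algebra_simps)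
  qed
  have um: "u (j + int N * m) = u j" for j m
    unfolding u_def by (metis (no_types, lifting) add_diff_eq add.commute diff_add_eq mod_mult_self2)
  obtain j where j: "u j = F j (u (j - 1)) (u (j + 1))"
    using no_losing_colouring[of u] per by blast
  define i where "i = k + 1 + (j - k - 1) mod int N"
  define m where "m = (j - k - 1) div int N"
  have ij: "j = i + int N * m"
    unfolding i_def m_def using mult_div_mod_eq[of "int N" "j - k - 1"] by linarith
  have i: "i \<in> {k<..k + int N}"
    proof -
    have "0 < int N" using N_ge by simp
    from pos_mod_bound[OF this, of "j - k - 1"] pos_mod_sign[OF this, of "j - k - 1"]
    show ?thesis unfolding i_def by simp
  qed
  have "u i = F i (u (i - 1)) (u (i + 1))"
    using j um[of i m] um[of "i - 1" m] um[of "i + 1" m] Fm[of i m] unfolding ij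
    by (simp add: algebra_simps)
  then show False using s(3)[OF i] i u[of i] u[of "i - 1"] u[of "i + 1"] by simp
qed

lemma out_le: "out k x y \<le> 3" and inn_le: "inn k x y \<le> 3"
  unfolding out_def inn_def using three_colours by (metis card_mono finite subset_UNIV)+

text \<open>Double counting: each of the three \<open>z\<close> excludes exactly one
  \<open>y\<close>.\<close>

lemma sum_out: "(\<Sum>y\<in>UNIV. out k x y) = 6"
proof -
  have "(\<Sum>y\<in>UNIV. out k x y) = (\<Sum>y\<in>UNIV. \<Sum>z\<in>UNIV. of_bool (F (k + 1) x z \<noteq> y))"
    unfolding out_def by (simp del: of_bool_not_iff)
  also have "\<dots> = (\<Sum>z\<in>UNIV. \<Sum>y\<in>UNIV. of_bool (y \<noteq> F (k + 1) x z))"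
    by (subst sum.swap) (simp only: eq_commute)
  also have "\<dots> = (\<Sum>z\<in>(UNIV::'a set). 2)"
    by (intro sum.cong refl) (simp add: card_neq three_colours del: of_bool_not_iff)
  also have "\<dots> = 6" using three_colours by simp
  finally show ?thesis .
qed

text \<open>Reversing the orientation of the cycle exchanges \<open>out\<close> and
  \<open>inn\<close>, so results on successors carry over to predecessors.\<close>

lemma reflected: "winning_cycle (\<lambda>k x z. F (- k) z x) N"
proof
  show "CARD('a) = 3" "4 \<le> N" by (fact three_colours N_ge)+
  show "(\<lambda>x z. F (- (k + int N)) z x) = (\<lambda>x z. F (- k) z x)" for k
    using periodic[of "- k - int N"] by simp
  show "\<exists>k. s k = F (- k) (s (k + 1)) (s (k - 1))" if "\<And>k. s (k + int N) = s k" for s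
  proof -
    have "s (- (k + int N)) = s (- k)" for k using that[of "- k - int N"] by simp
    then obtain k where "s (- k) = F k (s (- (k - 1))) (s (- (k + 1)))"
      using no_losing_colouring[of "\<lambda>k. s (- k)"] by blast
    then show ?thesis by (intro exI[of _ "- k"]) (metis add_uminus_conv_diff diff_minus_eq_add minus_diff_eq minus_add_distrib add.commute minus_minus)
  qed
qed

text \<open>The first step is free, and the second reaches \<open>(z, v)\<close> unless
  \<open>z\<close> is the guess. From then on the bound persists because two sets of two colours out
  of three always meet. The same pigeonhole argument later closes walks.\<close>

lemma spread:
  assumes "out k x y = 3" "n \<ge> 2"
  shows "card {u. walk k n (x, y) (u, v)} \<ge> 2"
  using assms(2)
proof (induction n arbitrary: v rule: dec_induct)
  case base
  have "{z. F (k + 1) x z \<noteq> y} = UNIV"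
    using assms(1) three_colours unfolding out_def by (intro card_subset_eq) auto
  then have "walk k 1 (x, y) (y, z)" for z
    using walk_Suc[OF walk_0, where k=k and x=x and y=y and z=z] by auto
  then have "walk k 2 (x, y) (z, v)" if "z \<noteq> F (k + 2) y v" for z
    using walk_Suc[of k 1 "(x, y)" y z v] that by (simp add: numeral_2_eq_2 algebra_simps)
  then have "card {z. z \<noteq> F (k + 2) y v} \<le> card {u. walk k 2 (x, y) (u, v)}"
    by (intro card_mono) auto
  then show ?case by (simp add: card_neq three_colours)
next
  case (step n)
  \<comment> \<open>A colour \<open>u\<close> is missed only if \<open>g\<close> maps at least two of the three colours to \<open>u\<close>.\<close>
  let ?A = "\<lambda>u. {w. walk k n (x, y) (w, u)}"
  define g where "g w = F (k + int n + 1) w v" for w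
  let ?M = "{u. \<not> walk k (Suc n) (x, y) (u, v)}"
  have miss: "g w = u" if "u \<in> ?M" "w \<in> ?A u" for u w
    using that walk_Suc[of k n "(x, y)" w u v] unfolding g_def by auto
  have "u = u'" if "u \<in> ?M" "u' \<in> ?M" for u u'
  proof -
    have "\<exists>w. w \<in> ?A u \<and> w \<in> ?A u'"
      using step.IH[of u] step.IH[of u'] three_colours by (intro exists_common_element) linarith
    then show ?thesis using miss that by blast
  qed
  then have "card ?M \<le> 1" by (simp add: card_le_Suc0_iff_eq)
  moreover have "card {u. walk k (Suc n) (x, y) (u, v)} = 3 - card ?M"
    using card_Diff_subset[of ?M UNIV] three_colours
    by (simp add: Compl_eq flip: Compl_eq_Diff_UNIV)
  ultimately show ?case by simp
qed

text \<open>One of two predecessors of \<open>(x, y)\<close> would be reached after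
  \<open>N - 1\<close> steps, and one more step would close the walk.\<close>

lemma out_3_inn_le_1:
  assumes "out k x y = 3"
  shows "inn k x y \<le> 1"
proof (rule ccontr)
  assume *: "\<not> ?thesis"
  have "\<exists>w. w \<in> {w. walk k (N - 1) (x, y) (w, x)} \<and> w \<in> {w. F k w y \<noteq> x}"
    using spread[OF assms, of "N - 1" x] * N_ge three_colours
    unfolding inn_def by (intro exists_common_element) linarith
  then obtain w where w: "walk k (N - 1) (x, y) (w, x)" "F (k + int N) w y \<noteq> x"
    using periodic by auto
  then show False
    using walk_Suc[of k "N - 1" "(x, y)" w x y] N_ge no_closed_walk[of k "(x, y)"]
    by (simp add: of_nat_diff)
qed

text \<open>The same argument one player earlier: one of two predecessors of \<open>(w, x)\<close>
  would be reached after \<open>N - 2\<close> steps.\<close>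

lemma out_3_pred_inn_le_1:
  assumes "out k x y = 3" "F k w y \<noteq> x"
  shows "inn (k - 1) w x \<le> 1"
proof (rule ccontr)
  assume *: "\<not> ?thesis"
  have "\<exists>v. v \<in> {v. walk k (N - 2) (x, y) (v, w)} \<and> v \<in> {v. F (k - 1) v x \<noteq> w}"
    using spread[OF assms(1), of "N - 2" w] * N_ge three_colours
    unfolding inn_def by (intro exists_common_element) linarith
  then obtain v where v: "walk k (N - 2) (x, y) (v, w)" "F (k - 1 + int N) v x \<noteq> w"
    using periodic by auto
  moreover have N: "Suc (N - 2) = N - 1" "Suc (N - 1) = N"
    "k + int (N - 2) + 1 = k - 1 + int N" "k + int (N - 1) + 1 = k + int N" using N_ge by auto
  ultimately have "walk k (N - 1) (x, y) (w, x)"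
    using walk_Suc[of k "N - 2" "(x, y)" v w x] by (simp add: algebra_simps)
  then have "walk k N (x, y) (x, y)"
    using walk_Suc[of k "N - 1" "(x, y)" w x y] assms(2) N periodic by simp
  then show False using no_closed_walk by blast
qed

lemma inn_3_out_le_1:
  assumes "inn k x y = 3"
  shows "out k x y \<le> 1"
proof -
  interpret r: winning_cycle "\<lambda>k x z. F (- k) z x" N by (rule reflected)
  have "r.out (- k - 1) y x = 3" using assms unfolding r.out_def inn_def by simp
  from r.out_3_inn_le_1[OF this] show ?thesis unfolding r.inn_def out_def by (simp add: algebra_simps)
qed

lemma sum_inn: "(\<Sum>x\<in>UNIV. inn k x y) = 6"
proof -
  interpret r: winning_cycle "\<lambda>k x z. F (- k) z x" N by (rule reflected)
  show ?thesis using r.sum_out[of "- k - 1" y] unfolding r.out_def inn_def by simp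
qed

text \<open>No pair exceeds 4, while the nine pairs together give 18 + 18 = 9 * 4, so equality holds
  everywhere.\<close>

lemma out_plus_inn: "out k x y + inn k x y = 4"
proof -
  have le: "out k x y + inn k x y \<le> 4" for x y
    using out_le[of k x y] inn_le[of k x y] out_3_inn_le_1[of k x y] inn_3_out_le_1[of k x y] by linarith
  have "(\<Sum>x\<in>UNIV. \<Sum>y\<in>UNIV. out k x y + inn k x y) = (\<Sum>x\<in>(UNIV::'a set). \<Sum>y\<in>(UNIV::'a set). 4 :: nat)"
    using sum_out[of k] sum_inn[of k] three_colours
    by (simp add: sum.distrib sum.swap[of "\<lambda>x y. inn k x y"])
  then have "(\<Sum>y\<in>UNIV. out k x y + inn k x y) = (\<Sum>y\<in>(UNIV::'a set). 4)"
    by (rule sum_mono_inv[of _ UNIV]) (rule sum_mono, rule le, simp_all)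
  then show ?thesis by (rule sum_mono_inv) (auto intro: le)
qed

subsection \<open>Heavy pairs\<close>

definition heavy :: "int \<Rightarrow> 'a \<Rightarrow> 'a \<Rightarrow> bool" where
  "heavy k x y \<longleftrightarrow> out k x y = 3"

definition heavy_dom :: "int \<Rightarrow> 'a set" where
  "heavy_dom k = {x. \<exists>y. heavy k x y}"

lemma heavy_periodic: "heavy (k + int N) = heavy k"
  unfolding heavy_def out_def using periodic[of "k + 1"] by (simp add: algebra_simps)

lemma heavy_iff_inn: "heavy k x y \<longleftrightarrow> inn k x y = 1"
  unfolding heavy_def using out_plus_inn[of k x y] by linarith

lemma heavyD: "heavy k x y \<Longrightarrow> F (k + 1) x z \<noteq> y"
proof -
  assume "heavy k x y"
  then have "{z. F (k + 1) x z \<noteq> y} = UNIV"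
    using three_colours unfolding heavy_def out_def by (intro card_subset_eq) auto
  then show ?thesis by auto
qed

text \<open>Out-degrees are positive and sum to 6 in a row, which leaves no room for a second
  3.\<close>

lemma heavy_right_unique:
  assumes "heavy k x y" "heavy k x y'"
  shows "y = y'"
proof (rule ccontr)
  assume ne: "y \<noteq> y'"
  then have "{y, y'} \<noteq> UNIV" using three_colours by (metis card_2_iff numeral_eq_iff num.distinct(5))
  then obtain z where "z \<notin> {y, y'}" by blast
  moreover have "out k x z > 0" using out_plus_inn[of k x z] inn_le[of k x z] by linarith
  ultimately have "sum (out k x) {y, y'} < sum (out k x) UNIV"
    by (intro sum_strict_mono2[of _ _ z]) auto
  then show False using assms ne sum_out[of k x] unfolding heavy_def by simp
qed

text \<open>Two in-degrees 1 and a third of at most 3 cannot reach the column sum 6.\<close>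

lemma heavy_left_unique:
  assumes "heavy k x y" "heavy k x' y"
  shows "x = x'"
proof (rule ccontr)
  assume ne: "x \<noteq> x'"
  have "(\<Sum>x\<in>UNIV. inn k x y) = (\<Sum>x\<in>{x, x'}. inn k x y) + (\<Sum>x\<in>UNIV - {x, x'}. inn k x y)"
    by (metis add.commute finite sum.subset_diff subset_UNIV)
  moreover have "(\<Sum>x\<in>UNIV - {x, x'}. inn k x y) \<le> card (UNIV - {x, x'}) * 3"
    using sum_bounded_above[of "UNIV - {x, x'}" "\<lambda>x. inn k x y" 3] inn_le by simp
  moreover have "card (UNIV - {x, x'}) = 1"
    using ne three_colours by (simp add: card_Diff_subset)
  ultimately show False using assms ne sum_inn[of k y] unfolding heavy_iff_inn by simp
qed

text \<open>The only predecessor itself has in-degree at most 1, hence out-degree 3. That it is the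
  only one fixes the guess for all other left colours.\<close>

lemma heavy_pred:
  assumes "heavy k x y"
  obtains w where "heavy (k - 1) w x" "\<And>w'. w' \<noteq> w \<Longrightarrow> F k w' y = x"
proof -
  obtain w where w: "{w. F k w y \<noteq> x} = {w}"
    using assms unfolding heavy_iff_inn inn_def by (auto simp: card_1_singleton_iff)
  have "inn (k - 1) w x \<le> 1"
    using out_3_pred_inn_le_1[of k x y w] w assms unfolding heavy_def by auto
  then have "heavy (k - 1) w x"
    using out_plus_inn[of "k - 1" w x] out_le[of "k - 1" w x] unfolding heavy_def by linarith
  then show ?thesis using w by (intro that[of w]) auto
qed

section \<open>Heavy chains run around the whole cycle\<close>

lemma card_heavy_range: "card {y. \<exists>x. heavy k x y} = card (heavy_dom k)"
proof -
  obtain h where h: "bij h" "\<And>x y. heavy k x y \<Longrightarrow> y = h x"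
    using partial_injection_extends_to_bij[of "heavy k"] heavy_left_unique heavy_right_unique
    by metis
  have "{y. \<exists>x. heavy k x y} = h ` heavy_dom k" unfolding heavy_dom_def using h(2) by auto
  then show ?thesis using h(1) by (metis bij_is_inj card_image inj_on_subset subset_UNIV)
qed

lemma heavy_dom_subset: "heavy_dom k \<subseteq> {y. \<exists>x. heavy (k - 1) x y}"
  unfolding heavy_dom_def using heavy_pred by blast

lemma card_heavy_dom_antimono: "card (heavy_dom (k + int n)) \<le> card (heavy_dom k)"
proof (induction n)
  case (Suc n)
  have "card (heavy_dom (k + int (Suc n))) \<le> card (heavy_dom (k + int n))"
    using card_mono[OF _ heavy_dom_subset[of "k + int (Suc n)"]]
      card_heavy_range[of "k + int n"] by (simp add: algebra_simps)
  then show ?case using Suc by linarith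
qed simp

text \<open>Every heavy pair has a heavy predecessor, so the number of chains cannot grow along the
  cycle. It returns to its value after \<open>N\<close> steps, hence is constant, and no chain
  ends.\<close>

lemma heavy_range: "{y. \<exists>x. heavy k x y} = heavy_dom (k + 1)"
proof -
  have "heavy_dom k = heavy_dom (k + 1 + int (N - 1))"
    using heavy_periodic[of k] N_ge unfolding heavy_dom_def by (simp add: of_nat_diff)
  then have "card {y. \<exists>x. heavy k x y} \<le> card (heavy_dom (k + 1))"
    using card_heavy_dom_antimono[of "k + 1" "N - 1"] card_heavy_range[of k] by simp
  then show ?thesis
    using heavy_dom_subset[of "k + 1"] card_seteq[of "{y. \<exists>x. heavy k x y}" "heavy_dom (k + 1)"]
    by simp
qed

section \<open>Rows and columns off the chains\<close>

lemma light_row: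
  assumes "x \<notin> heavy_dom k"
  shows "out k x y = 2"
proof -
  have le: "out k x y \<le> 2" for y
    using assms out_le[of k x y] unfolding heavy_dom_def heavy_def
    by (metis (mono_tags) le_neq_implies_less less_Suc_eq_le mem_Collect_eq numeral_2_eq_2 numeral_3_eq_3)
  have "(\<Sum>y\<in>UNIV. out k x y) = (\<Sum>y\<in>(UNIV::'a set). 2)"
    using sum_out three_colours by simp
  then show ?thesis by (rule sum_mono_inv) (auto intro: le)
qed

lemma light_column:
  assumes "y \<notin> heavy_dom (k + 1)"
  shows "inn k x y = 2"
proof -
  have le: "2 \<le> inn k x y" for x
    using assms heavy_iff_inn[of k x y] out_plus_inn[of k x y] out_le[of k x y]
    unfolding heavy_range[symmetric] heavy_def by fastforce
  have "(\<Sum>x\<in>(UNIV::'a set). 2) = (\<Sum>x\<in>UNIV. inn k x y)"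
    using sum_inn three_colours by simp
  then show ?thesis by (rule sum_mono_inv[symmetric]) (auto intro: le)
qed

text \<open>Two equal values would leave at most one argument with a different value.\<close>

lemma inj_if_card_neq_2:
  fixes g :: "'a \<Rightarrow> 'a"
  assumes "\<And>y. card {z. g z \<noteq> y} = 2"
  shows "inj g"
proof (rule injI, rule ccontr)
  fix z z' assume "g z = g z'" "z \<noteq> z'"
  then have "{w. g w \<noteq> g z} \<subseteq> UNIV - {z, z'}" by auto
  then have "card {w. g w \<noteq> g z} \<le> card (UNIV - {z, z'})" by (intro card_mono) auto
  also have "\<dots> = 1" using \<open>z \<noteq> z'\<close> three_colours by (simp add: card_Diff_subset)
  finally show False using assms[of "g z"] by simp
qed

lemma light_row_inj: "x \<notin> heavy_dom k \<Longrightarrow> inj (F (k + 1) x)"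
  using light_row[of x k] unfolding out_def by (intro inj_if_card_neq_2)

lemma light_column_inj: "y \<notin> heavy_dom (k + 1) \<Longrightarrow> inj (\<lambda>w. F k w y)"
  using light_column[of y k] unfolding inn_def by (intro inj_if_card_neq_2)

text \<open>Without chains all degrees are 2. At least six of the nine pairs are then reached after
  \<open>N - 2\<close> steps, and four pairs lead back to the start in two steps; since 6 + 4 > 9,
  some walk closes.\<close>

lemma heavy_dom_nonempty:
  assumes "N \<ge> 5"
  shows "heavy_dom 0 \<noteq> {}"
proof
  assume "heavy_dom 0 = {}"
  then have empty: "heavy_dom (int n) = {}" for n
    using card_heavy_dom_antimono[of 0 n] by simp
  have out: "out (int n) x y = 2" for n x y by (rule light_row) (simp add: empty)
  have inn: "inn (int n) x y = 2" for n x y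
    by (rule light_column) (use empty[of "Suc n"] in \<open>simp add: add.commute\<close>)
  fix x y :: 'a
  let ?S = "\<lambda>n. {p. walk 0 n (x, y) p}"
  let ?R = "\<lambda>n b. {c. walk 0 n (x, y) (b, c)}" and ?C = "\<lambda>n b. {a. walk 0 n (x, y) (a, b)}"
  \<comment> \<open>Pairs ending in \<open>b\<close> are followed by pairs starting with
    \<open>b\<close>. One of them already yields two successors, and all three yield all three
    because every pair has a predecessor. So the number of reached pairs never drops.\<close>
  have step: "card (?C n b) \<le> card (?R (Suc n) b) \<and> (?C n b \<noteq> {} \<longrightarrow> 2 \<le> card (?R (Suc n) b))" for n b
  proof (cases "?C n b = {}")
    case False
    then obtain a where a: "walk 0 n (x, y) (a, b)" by blast
    then have "{c. F (int n + 1) a c \<noteq> b} \<subseteq> ?R (Suc n) b" using walk_Suc[of 0 n _ a b] by auto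
    then have two: "2 \<le> card (?R (Suc n) b)"
      using out[of n a b] card_mono[of "?R (Suc n) b"] unfolding out_def by (metis finite)
    moreover have "card (?C n b) \<le> card (?R (Suc n) b)"
    proof (cases "card (?C n b) \<le> 2")
      case False
      then have "?C n b = UNIV"
        using three_colours card_seteq[of UNIV "?C n b"] by auto
      moreover have "\<exists>a. F (int (Suc n)) a c \<noteq> b" for c
      proof -
        have "{a. F (int (Suc n)) a c \<noteq> b} \<noteq> {}"
          using inn[of "Suc n" b c] unfolding inn_def by force
        then show ?thesis by blast
      qed
      ultimately have "?R (Suc n) b = UNIV"
        using walk_Suc[of 0 n "(x, y)" _ b] by (auto simp: set_eq_iff algebra_simps)
      then show ?thesis by (simp add: card_mono)
    qed (use two in linarith)
    ultimately show ?thesis by simp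
  qed simp
  have "?C 2 b \<noteq> {}" for b
  proof -
    have "\<exists>z. z \<in> {z. F 1 x z \<noteq> y} \<and> z \<in> {z. z \<noteq> F 2 y b}"
      using out[of 0 x y] three_colours unfolding out_def
      by (intro exists_common_element) (simp add: card_neq)
    then obtain z where "F 1 x z \<noteq> y" "F 2 y b \<noteq> z" by auto
    then have "walk 0 (Suc (Suc 0)) (x, y) (z, b)"
      by (intro walk_Suc[of _ _ _ y] walk_Suc[of _ _ _ x] walk_0) auto
    then show ?thesis by (auto simp: numeral_2_eq_2)
  qed
  then have "2 \<le> card (?R 3 b)" for b using step[of 2 b] by (simp add: numeral_3_eq_3 numeral_2_eq_2)
  then have "(\<Sum>b\<in>(UNIV::'a set). 2) \<le> (\<Sum>b\<in>UNIV. card (?R 3 b))" by (intro sum_mono)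
  then have three: "6 \<le> card (?S 3)" unfolding card_slices(1) using three_colours by simp
  have "6 \<le> card (?S n)" if "n \<ge> 3" for n using that
  proof (induction n rule: dec_induct)
    case (step n)
    have "card (?S n) \<le> card (?S (Suc n))"
      unfolding card_slices(2)[of "walk 0 n (x, y)"] card_slices(1)[of "walk 0 (Suc n) (x, y)"]
      using \<open>\<And>n b. card (?C n b) \<le> card (?R (Suc n) b) \<and> _\<close> by (intro sum_mono) blast
    then show ?case using step.IH by linarith
  qed (rule three)
  then have S: "6 \<le> card (?S (N - 2))" using assms by simp
  \<comment> \<open>The pairs from which \<open>(x, y)\<close> is reached in the last two steps: two
    choices of \<open>w\<close>, each with two of \<open>v\<close>.\<close>
  define T where "T = {(v, w). F (int N) w y \<noteq> x \<and> F (int (N - 1)) v x \<noteq> w}"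
  have "card T = (\<Sum>w\<in>UNIV. card {v. F (int N) w y \<noteq> x \<and> F (int (N - 1)) v x \<noteq> w})"
    unfolding T_def using card_slices(2)[of "\<lambda>(v, w). F (int N) w y \<noteq> x \<and> F (int (N - 1)) v x \<noteq> w"] by simp
  also have "\<dots> = (\<Sum>w\<in>UNIV. of_bool (F (int N) w y \<noteq> x) * inn (int (N - 1)) w x)"
    unfolding inn_def by (intro sum.cong) auto
  also have "\<dots> = (\<Sum>w\<in>UNIV. of_bool (F (int N) w y \<noteq> x)) * 2"
    unfolding inn sum_distrib_right ..
  also have "\<dots> = inn (int N) x y * 2" unfolding inn_def by (simp del: of_bool_not_iff)
  finally have "card T = 4" unfolding inn by simp
  then obtain v w where vw: "walk 0 (N - 2) (x, y) (v, w)" "F (int N) w y \<noteq> x"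
      "F (int (N - 1)) v x \<noteq> w"
    using exists_common_element[of "?S (N - 2)" T] S three_colours unfolding T_def by auto
  have N: "Suc (N - 2) = N - 1" "Suc (N - 1) = N" using N_ge by auto
  then have walk: "walk 0 (N - 1) (x, y) (w, x)"
    using walk_Suc[OF vw(1), of x] vw(3) N_ge by (simp add: N(1) of_nat_diff)
  have "0 + int (N - 1) + 1 = int N" using N_ge by simp
  then have "walk 0 N (x, y) (x, y)"
    using walk_Suc[OF walk, of y] vw(2) N(2) by metis
  then show False using no_closed_walk by blast
qed

subsection \<open>Normal form along the heavy chains\<close>

text \<open>A permutation of all colours that follows the chains; off the chains it is an arbitrary
  completion.\<close>

definition transport :: "int \<Rightarrow> 'a \<Rightarrow> 'a" where
  "transport k = (SOME h. bij h \<and> (\<forall>x y. heavy k x y \<longrightarrow> y = h x))"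

text \<open>New colour names in which every chain is constant. They are not periodic:
  \<open>chart N\<close> is the holonomy.\<close>

primrec chart :: "nat \<Rightarrow> 'a \<Rightarrow> 'a" where
  "chart 0 = id"
| "chart (Suc n) = transport (int n) \<circ> chart n"

lemma transport: "bij (transport k)" "heavy k x y \<Longrightarrow> y = transport k x"
proof -
  have "\<exists>h. bij h \<and> (\<forall>x y. heavy k x y \<longrightarrow> y = h x)"
    using partial_injection_extends_to_bij[of "heavy k"] heavy_left_unique heavy_right_unique
    by metis
  from someI_ex[OF this] show "bij (transport k)" "heavy k x y \<Longrightarrow> y = transport k x"
    unfolding transport_def by blast+
qed

lemma transport_periodic: "transport (k + int N) = transport k"
  unfolding transport_def heavy_periodic ..

lemma bij_chart: "bij (chart n)"
proof (induction n)
  case (Suc n)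
  then show ?case unfolding chart.simps by (intro bij_comp transport(1))
qed (unfold chart.simps, rule bij_id)

lemma chart_eq_iff: "chart n x = chart n y \<longleftrightarrow> x = y"
  using bij_chart[of n] by (auto simp: bij_def inj_eq)

lemma chart_surj: "\<exists>x. y = chart n x"
  by (rule surjD[OF bij_is_surj[OF bij_chart]])

lemma chart_in_heavy_dom: "chart n x \<in> heavy_dom (int n) \<longleftrightarrow> x \<in> heavy_dom 0"
proof (induction n)
  case (Suc n)
  have "transport (int n) u \<in> heavy_dom (int n + 1) \<longleftrightarrow> u \<in> heavy_dom (int n)" for u
  proof
    assume "transport (int n) u \<in> heavy_dom (int n + 1)"
    then obtain v where v: "heavy (int n) v (transport (int n) u)"
      unfolding heavy_range[symmetric] by blast
    then have "transport (int n) u = transport (int n) v" by (rule transport(2))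
    then have "u = v" by (rule injD[OF bij_is_inj[OF transport(1)]])
    then show "u \<in> heavy_dom (int n)" using v unfolding heavy_dom_def by blast
  next
    assume "u \<in> heavy_dom (int n)"
    then obtain y where y: "heavy (int n) u y" unfolding heavy_dom_def by blast
    with transport(2)[OF y] show "transport (int n) u \<in> heavy_dom (int n + 1)"
      unfolding heavy_range[symmetric] by blast
  qed
  moreover have "int (Suc n) = int n + 1" by simp
  ultimately show ?case using Suc by (simp only: chart.simps o_apply)
qed simp

lemma chart_heavy:
  assumes "x \<in> heavy_dom 0"
  shows "heavy (int n) (chart n x) (chart (Suc n) x)"
  using assms chart_in_heavy_dom[of n x] transport(2)[of "int n" "chart n x"]
  unfolding heavy_dom_def by auto

text \<open>The transition rule of walks, written in the names given by
  \<open>chart\<close>.\<close>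

definition allowed :: "nat \<Rightarrow> 'a \<Rightarrow> 'a \<Rightarrow> 'a \<Rightarrow> bool" where
  "allowed n x y z \<longleftrightarrow>
     F (int n + 1) (chart n x) (chart (n + 2) z) \<noteq> chart (Suc n) y"

lemma allowed_heavy: "x \<in> heavy_dom 0 \<Longrightarrow> allowed n x x z"
  unfolding allowed_def using chart_heavy heavyD by blast

text \<open>The heavy pair of chain \<open>z\<close> at players \<open>n + 1\<close>,
  \<open>n + 2\<close> has only the predecessor on the same chain, so any other left colour must
  make player \<open>n + 1\<close> guess \<open>z\<close>.\<close>

lemma guess_right:
  assumes "z \<in> heavy_dom 0" "x \<noteq> z"
  shows "F (int n + 1) (chart n x) (chart (n + 2) z) = chart (Suc n) z"
proof -
  have h: "heavy (int n + 1) (chart (Suc n) z) (chart (n + 2) z)"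
    using chart_heavy[OF assms(1), of "Suc n"] by (simp add: add.commute)
  from heavy_pred[OF this] obtain w where
    w: "heavy (int n) w (chart (Suc n) z)"
    "\<And>w'. w' \<noteq> w \<Longrightarrow> F (int n + 1) w' (chart (n + 2) z) = chart (Suc n) z" by auto
  have "w = chart n z" using w(1) chart_heavy[OF assms(1), of n] heavy_left_unique by blast
  then show ?thesis using w(2)[of "chart n x"] assms(2) chart_eq_iff by auto
qed

lemma allowed_right: "z \<in> heavy_dom 0 \<Longrightarrow> x \<noteq> z \<Longrightarrow> y \<noteq> z \<Longrightarrow> allowed n x y z"
  unfolding allowed_def using guess_right chart_eq_iff by metis

text \<open>In the new names a walk closes up to the holonomy. Both end colours are compared through
  \<open>chart N\<close>, since \<open>transport\<close> takes the same value at \<open>N\<close>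
  and at 0.\<close>

lemma no_twisted_closed_walk:
  assumes "\<And>n. n < N \<Longrightarrow> allowed n (t n) (t (n + 1)) (t (n + 2))"
    "chart N (t N) = t 0" "chart N (t (N + 1)) = t 1"
  shows False
proof -
  let ?s = "\<lambda>j. chart (nat j) (t (nat j))"
  have "walk 0 N (t 0, chart 1 (t 1)) (t 0, chart 1 (t 1))"
    unfolding walk_def
  proof (intro exI[of _ ?s] conjI ballI)
    have "nat (int N + 1) = Suc N" by simp
    then show "(t 0, chart 1 (t 1)) = (?s (0 + int N), ?s (0 + int N + 1))"
      using assms(2,3) transport_periodic[of 0] by simp
    fix j assume "j \<in> {0<..0 + int N}"
    then obtain n where n: "j = int (Suc n)" "n < N"
      by (metis Suc_le_eq add_0 greaterThanAtMost_iff of_nat_le_iff pos_int_cases gr0_implies_Suc)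
    have "nat (j - 1) = n" "nat j = Suc n" "nat (j + 1) = n + 2" using n by auto
    then show "?s j \<noteq> F j (?s (j - 1)) (?s (j + 1))"
      using assms(1)[OF n(2)] n(1) unfolding allowed_def by (auto simp: add.commute)
  qed auto
  then show False using no_closed_walk by blast
qed

section \<open>Holonomy and the possible numbers of chains\<close>

lemma holonomy_no_fixpoint:
  assumes "x \<in> heavy_dom 0"
  shows "chart N x \<noteq> x"
  \<comment> \<open>A fixed chain would be a constant walk that closes.\<close>
  using no_twisted_closed_walk[of "\<lambda>_. x"] allowed_heavy[OF assms] by auto

lemma holonomy_heavy_dom: "chart N x \<in> heavy_dom 0 \<longleftrightarrow> x \<in> heavy_dom 0"
  using chart_in_heavy_dom[of N x] heavy_periodic[of 0] unfolding heavy_dom_def by simp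

text \<open>The row of \<open>c\<close> is injective and takes the values \<open>p\<close> and
  \<open>q\<close> at \<open>p\<close> and \<open>q\<close>, so the guess between two
  \<open>c\<close> is \<open>c\<close>. Injectivity of the column of \<open>c\<close> then excludes
  the guess \<open>c\<close> for other left colours.\<close>

lemma allowed_centre:
  assumes "UNIV = {p, q, c}" "heavy_dom 0 = {p, q}" "c \<notin> {p, q}" "p \<noteq> q"
  shows "x \<in> {p, q} \<Longrightarrow> allowed n x c c" "x \<in> {p, q} \<Longrightarrow> allowed n c x c"
proof -
  have row: "inj (F (int n + 1) (chart n c))"
    using assms(2,3) by (intro light_row_inj) (simp add: chart_in_heavy_dom)
  have col: "inj (\<lambda>w. F (int n + 1) w (chart (n + 2) c))"
    using assms(2,3) chart_in_heavy_dom[of "n + 2" c] by (intro light_column_inj) (simp add: add.commute)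
  have "F (int n + 1) (chart n c) (chart (n + 2) u) = chart (Suc n) u" if "u \<in> {p, q}" for u
    using guess_right[of u c n] that assms by auto
  then have "F (int n + 1) (chart n c) (chart (n + 2) c) \<noteq> chart (Suc n) u" if "u \<in> {p, q}" for u
    using that row assms(3) chart_eq_iff[of "n + 2" c u] by (metis injD)
  moreover obtain u where "F (int n + 1) (chart n c) (chart (n + 2) c) = chart (Suc n) u"
    using chart_surj by blast
  ultimately have cc: "F (int n + 1) (chart n c) (chart (n + 2) c) = chart (Suc n) c"
    using assms(1) by (metis UNIV_I insert_iff singleton_iff)
  then show "x \<in> {p, q} \<Longrightarrow> allowed n c x c"
    unfolding allowed_def using chart_eq_iff assms(3) by metis
  show "x \<in> {p, q} \<Longrightarrow> allowed n x c c"
    unfolding allowed_def using col cc assms(3) chart_eq_iff by (metis injD)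
qed

lemma card_heavy_dom_neq_2:
  assumes "N \<ge> 5"
  shows "card (heavy_dom 0) \<noteq> 2"
proof
  assume "card (heavy_dom 0) = 2"
  then obtain p q where pq: "heavy_dom 0 = {p, q}" "p \<noteq> q" by (auto simp: card_2_iff)
  then have "card (UNIV - {p, q}) = 1" using three_colours by (simp add: card_Diff_subset)
  then obtain c where c: "UNIV - {p, q} = {c}" by (auto simp: card_1_singleton_iff)
  then have U: "UNIV = {p, q, c}" "c \<notin> {p, q}" by auto
  note centre = allowed_centre[OF U(1) pq(1) U(2) pq(2)]
  \<comment> \<open>The holonomy preserves \<open>{p, q}\<close> without fixed points there, so it
    swaps \<open>p\<close> and \<open>q\<close> and fixes \<open>c\<close>.\<close>
  have H: "chart N q = p" "chart N c = c"
    using holonomy_no_fixpoint[of p] holonomy_no_fixpoint[of q] holonomy_heavy_dom[of q]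
      holonomy_heavy_dom[of c] U pq by auto
  have right: "allowed n x y z" if "z \<in> {p, q}" "x \<noteq> z" "y \<noteq> z" for n x y z
    using allowed_right that pq(1) by blast
  \<comment> \<open>Counted back from \<open>N\<close> so that \<open>e N = q\<close>, which the
    holonomy takes to the starting colour \<open>p\<close>.\<close>
  define e where "e n = (if even ((N - n) div 2) then q else p)" for n
  have e: "e m \<noteq> c" "e m \<in> {p, q}" for m using U(2) by (auto simp: e_def)
  have pc: "p \<noteq> c" using U(2) by auto
  have steps: "allowed n p c c" "allowed n c c p" "allowed n c p c"
    "allowed n c c (e m)" "allowed n c (e m) c" for n m
    using centre(1)[of p n] centre(2)[of p n] centre(2)[of "e m" n]
      right[of p c c n] right[of "e m" c c n] e[of m] pc by auto
  have alternate: "e (n + 2) \<noteq> e n" if "n + 2 \<le> N" for n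
  proof -
    have "(N - n) div 2 = Suc ((N - (n + 2)) div 2)" using that by (simp add: le_div_geq)
    then show ?thesis unfolding e_def using pq(2) by simp
  qed
  \<comment> \<open>Steps of length 2 (\<open>x c x'\<close> with \<open>x \<noteq> x'\<close>) force the next colour of \<open>{p, q}\<close>,
    steps of length 3 (\<open>x c c x'\<close>) leave it free. Every \<open>N \<ge> 5\<close> is the length of a chain of
    such steps with a step of length 3 in it, so the chain can end in the colour that closes up.\<close>
  show False
  proof (cases "odd N")
    case True
    \<comment> \<open>One step of length 3, then steps of length 2.\<close>
    let ?t = "\<lambda>n. if n = 0 then p else if n < 3 \<or> even n then c else e n"
    show False
    proof (rule no_twisted_closed_walk[of ?t])
      fix n assume "n < N"
      consider "n = 0" | "n = 1" | "n = 2" | "n \<ge> 3" "odd n" | "n \<ge> 3" "even n" by linarith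
      then show "allowed n (?t n) (?t (n + 1)) (?t (n + 2))"
      proof cases
        case 4
        then have "n + 2 \<le> N" using \<open>n < N\<close> True by presburger
        then have "allowed n (e n) c (e (n + 2))"
          using alternate[of n] e by (intro right) auto
        then show ?thesis using 4 by simp
      qed (simp_all add: steps)
    qed (use True assms H in \<open>simp_all add: e_def\<close>)
  next
    case False
    then have "N \<ge> 6" using assms by (cases "N = 5") auto
    \<comment> \<open>Two steps of length 3 restore the parity.\<close>
    let ?t = "\<lambda>n. if n = 0 \<or> n = 3 then p else if n < 6 \<or> odd n then c else e n"
    show False
    proof (rule no_twisted_closed_walk[of ?t])
      fix n assume "n < N"
      consider "n = 0" | "n = 1" | "n = 2" | "n = 3" | "n = 4" | "n = 5"
        | "n \<ge> 6" "even n" | "n \<ge> 6" "odd n" by linarith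
      then show "allowed n (?t n) (?t (n + 1)) (?t (n + 2))"
      proof cases
        case 7
        then have "n + 2 \<le> N" using \<open>n < N\<close> False by presburger
        then have "allowed n (e n) c (e (n + 2))"
          using alternate[of n] e by (intro right) auto
        then show ?thesis using 7 by simp
      qed (simp_all add: steps)
    qed (use False \<open>N \<ge> 6\<close> H in \<open>simp_all add: e_def\<close>)
  qed
qed

lemma card_heavy_dom_neq_1: "card (heavy_dom 0) \<noteq> 1"
proof
  assume "card (heavy_dom 0) = 1"
  then obtain p where "heavy_dom 0 = {p}" by (auto simp: card_1_singleton_iff)
  then show False using holonomy_no_fixpoint[of p] holonomy_heavy_dom[of p] by auto
qed

text \<open>Every colour is now on a chain, so any three distinct consecutive colours are allowed.
  The holonomy is a 3-cycle \<open>p\<close>, \<open>q\<close>, \<open>r\<close>, and a colouring of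
  period 3 in the right cyclic order closes whenever \<open>N\<close> is not a multiple of
  3.\<close>

lemma dvd_if_card_heavy_dom_3:
  assumes "card (heavy_dom 0) = 3"
  shows "3 dvd N"
proof (rule ccontr)
  assume "\<not> 3 dvd N"
  have U: "heavy_dom 0 = UNIV" using assms three_colours by (intro card_subset_eq) auto
  have nf: "chart N x \<noteq> x" for x using holonomy_no_fixpoint[of x] U by auto
  fix p :: 'a
  define q where "q = chart N p"
  have "p \<noteq> q" unfolding q_def using nf by metis
  then have "card (UNIV - {p, q}) = 1" using three_colours by (simp add: card_Diff_subset)
  then obtain r where r: "UNIV - {p, q} = {r}" by (auto simp: card_1_singleton_iff)
  then have pqr: "UNIV = {p, q, r}" "r \<noteq> p" "r \<noteq> q" by auto
  have "chart N r \<noteq> q" unfolding q_def chart_eq_iff by (rule pqr(2))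
  then have Hr: "chart N r = p" using nf[of r] pqr(1) by blast
  have "chart N q \<noteq> p" unfolding Hr[symmetric] chart_eq_iff using pqr(3) by metis
  then have Hq: "chart N q = r" using nf[of q] pqr(1) by blast
  have right: "allowed n x y z" if "x \<noteq> z" "y \<noteq> z" for n x y z
    using allowed_right that U by blast
  \<comment> \<open>The closing conditions determine \<open>a\<close> and \<open>b\<close>: the
    holonomy must take \<open>?t a b N\<close> to \<open>p\<close> and \<open>?t a b (N + 1)\<close>
    to \<open>a\<close>.\<close>
  let ?t = "\<lambda>a b n. if n mod 3 = (0::nat) then p else if n mod 3 = 1 then a else b"
  have mod3: "n mod 3 = 0 \<or> n mod 3 = 1 \<or> n mod 3 = 2" for n :: nat by linarith
  consider "N mod 3 = 1" | "N mod 3 = 2" using \<open>\<not> 3 dvd N\<close> mod3[of N] by (auto simp: dvd_eq_mod_eq_0)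
  then show False
  proof cases
    case 1
    show False
    proof (rule no_twisted_closed_walk[of "?t r q"])
      fix n
      show "allowed n (?t r q n) (?t r q (n + 1)) (?t r q (n + 2))"
        using mod3[of n] \<open>p \<noteq> q\<close> pqr(2,3) by (elim disjE) (auto simp: mod_Suc intro!: right)
    qed (use 1 Hr Hq in \<open>auto simp: mod_Suc\<close>)
  next
    case 2
    show False
    proof (rule no_twisted_closed_walk[of "?t q r"])
      fix n
      show "allowed n (?t q r n) (?t q r (n + 1)) (?t q r (n + 2))"
        using mod3[of n] \<open>p \<noteq> q\<close> pqr(2,3) by (elim disjE) (auto simp: mod_Suc intro!: right)
    qed (use 2 Hr q_def in \<open>auto simp: mod_Suc\<close>)
  qed
qed

theorem winning_cycle_length: "3 dvd N \<or> N = 4"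
proof (rule ccontr)
  assume *: "\<not> (3 dvd N \<or> N = 4)"
  then have "N \<ge> 5" using N_ge by simp
  then have "card (heavy_dom 0) \<noteq> 0" using heavy_dom_nonempty by simp
  moreover have "card (heavy_dom 0) \<le> 3" using three_colours by (metis card_mono finite subset_UNIV)
  ultimately have "card (heavy_dom 0) = 3"
    using card_heavy_dom_neq_1 card_heavy_dom_neq_2[OF \<open>N \<ge> 5\<close>] by linarith
  then show False using dvd_if_card_heavy_dom_3 * by blast
qed

end

subsection \<open>Three standard colours\<close>

definition wins :: "nat \<Rightarrow> (nat \<Rightarrow> 3 \<Rightarrow> 3 \<Rightarrow> 3) \<Rightarrow> bool" where
  "wins N G \<longleftrightarrow>
     (\<forall>s. \<exists>k<N. s k = G k (s (prev_player N k)) (s (next_player N k)))"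

lemma winning_guess:
  assumes "winning N V f" "s \<in> colourings N V"
  obtains k where "k \<in> players N" "s k = f k (s (prev_player N k), s (next_player N k))"
  using assms unfolding winning_def by blast

text \<open>Bijections between each \<open>V k\<close> and the type \<open>3\<close> carry
  strategies and colourings back and forth.\<close>

lemma winning_iff_wins:
  fixes V :: "nat \<Rightarrow> 'c set"
  assumes "N > 0" "\<And>k. k \<in> players N \<Longrightarrow> card (V k) = 3"
  shows "(\<exists>f\<in>strategies N V. winning N V f) \<longleftrightarrow> (\<exists>G. wins N G)"
proof -
  let ?p = "prev_player N" and ?n = "next_player N"
  have "\<forall>k\<in>players N. \<exists>h. bij_betw h (UNIV :: 3 set) (V k)"
    using assms(2) by (auto intro!: finite_same_card_bij intro: card_ge_0_finite)
  then obtain e where e: "\<And>k. k \<in> players N \<Longrightarrow> bij_betw (e k) (UNIV :: 3 set) (V k)"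
    unfolding bchoice_iff by blast
  let ?d = "\<lambda>k. inv (e k)"
  have d: "?d k (e k x) = x" if "k \<in> players N" for k x
    using e[OF that] by (simp add: bij_betw_def)
  have ed: "e k (?d k a) = a" if "k \<in> players N" "a \<in> V k" for k a
    using e[OF that(1)] that(2) by (simp add: bij_betw_inv_into_right)
  have eV: "e k x \<in> V k" if "k \<in> players N" for k x
    using e[OF that] by (auto simp: bij_betw_def)
  have pn: "?p k \<in> players N" "?n k \<in> players N" for k
    using assms(1) by (simp_all add: players_def prev_player_def next_player_def)
  show ?thesis
  proof
    assume "\<exists>f\<in>strategies N V. winning N V f"
    then obtain f where f: "winning N V f" by blast
    have "wins N (\<lambda>k x z. ?d k (f k (e (?p k) x, e (?n k) z)))"
      unfolding wins_def
    proof
      fix s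
      have "(\<lambda>k. e k (s k)) \<in> colourings N V" by (simp add: colourings_def eV)
      then obtain k where k: "k \<in> players N" "e k (s k) = f k (e (?p k) (s (?p k)), e (?n k) (s (?n k)))"
        by (rule winning_guess[OF f])
      then show "\<exists>k<N. s k = ?d k (f k (e (?p k) (s (?p k)), e (?n k) (s (?n k))))"
        using d[OF k(1), of "s k"] by (intro exI[of _ k]) (simp add: players_def flip: k(2))
    qed
    then show "\<exists>G. wins N G" by blast
  next
    assume "\<exists>G. wins N G"
    then obtain G where G: "wins N G" by blast
    let ?f = "\<lambda>k (a, b). e k (G k (?d (?p k) a) (?d (?n k) b))"
    have "?f \<in> strategies N V" unfolding strategies_def by (intro Pi_I) (simp add: eV split: prod.split)
    moreover have "winning N V ?f"
      unfolding winning_def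
    proof
      assume "\<exists>s\<in>colourings N V. \<forall>k\<in>players N. s k \<noteq> ?f k (s (?p k), s (?n k))"
      then obtain s where s: "s \<in> colourings N V"
        "\<And>k. k \<in> players N \<Longrightarrow> s k \<noteq> ?f k (s (?p k), s (?n k))" by blast
      obtain k where k: "k < N" "?d k (s k) = G k (?d (?p k) (s (?p k))) (?d (?n k) (s (?n k)))"
        using G[unfolded wins_def, rule_format, of "\<lambda>k. ?d k (s k)"] by blast
      then have kN: "k \<in> players N" by (simp add: players_def)
      then have "s k \<in> V k" using s(1) by (auto simp: colourings_def)
      then have "e k (?d k (s k)) = s k" by (rule ed[OF kN])
      then have "?f k (s (?p k), s (?n k)) = s k" by (simp flip: k(2))
      then show False using s(2)[OF kN] by metis
    qed
    ultimately show "\<exists>f\<in>strategies N V. winning N V f" by blast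
  qed
qed

lemma wins_imp_length:
  assumes "N \<ge> 3" "wins N G"
  shows "3 dvd N \<or> N = 4"
proof (cases "N = 3")
  case False
  interpret winning_cycle "\<lambda>j. G (nat (j mod int N))" N
  proof
    show "CARD(3) = 3" by simp
    show "4 \<le> N" using assms(1) False by simp
    show "G (nat ((k + int N) mod int N)) = G (nat (k mod int N))" for k by simp
    fix s :: "int \<Rightarrow> 3" assume s: "\<And>k. s (k + int N) = s k"
    obtain k where k: "k < N"
      "s (int k) = G k (s (int (prev_player N k))) (s (int (next_player N k)))"
      using assms(2)[unfolded wins_def, rule_format, of "\<lambda>k. s (int k)"] by blast
    have "s (int (prev_player N k)) = s (int k - 1)"
    proof (cases "k = 0")
      case True
      then have "int (prev_player N k) = int k - 1 + int N"
        using assms(1) by (simp add: prev_player_def of_nat_diff)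
      then show ?thesis using s by metis
    next
      case False
      then have "k + (N - 1) = (k - 1) + N" using assms(1) by simp
      then have "prev_player N k = k - 1"
        using k(1) unfolding prev_player_def by (simp only: mod_add_self2) simp
      then show ?thesis using False by (simp add: of_nat_diff)
    qed
    moreover have "s (int (next_player N k)) = s (int k + 1)"
    proof (cases "k + 1 = N")
      case True
      then show ?thesis using s[of 0] by (auto simp: next_player_def add.commute)
    next
      case False
      then show ?thesis using k(1) by (simp add: next_player_def add.commute)
    qed
    ultimately show "\<exists>k. s k = G (nat (k mod int N)) (s (k - 1)) (s (k + 1))"
      using k by (intro exI[of _ "int k"]) simp
  qed
  show ?thesis by (rule winning_cycle_length)
qed simp

subsection \<open>Winning strategies\<close>

lemma three_cases: "(x :: 3) = 0 \<or> x = 1 \<or> x = 2"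
proof (cases x)
  case (of_int z)
  then have "z = 0 \<or> z = 1 \<or> z = 2" by auto
  then show ?thesis using of_int by auto
qed

text \<open>The normal form with three chains: unequal neighbours force \<open>z\<close> as in
  \<open>guess_right\<close>; for equal ones \<open>x + 1\<close> avoids \<open>x\<close> and
  commutes with rotations.\<close>

definition spiral_guess :: "3 \<Rightarrow> 3 \<Rightarrow> 3" where
  "spiral_guess x z = (if x = z then x + 1 else z)"

lemma spiral_guess_shift: "spiral_guess (x + c) (z + c) = spiral_guess x z + c"
  by (simp add: spiral_guess_def algebra_simps)

text \<open>Wrong guesses restrict the differences: 0 propagates backwards and 1 forwards. By
  periodicity they are constant, so \<open>t\<close> returns to its start after \<open>N\<close>
  steps if \<open>3 dvd N\<close>, against the twist.\<close>

lemma no_spiral: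
  fixes t :: "nat \<Rightarrow> 3"
  assumes avoids: "\<And>k. t (k + 1) \<noteq> spiral_guess (t k) (t (k + 2))"
    and twist: "\<And>k. t (k + N) = t k + 1"
  shows "\<not> 3 dvd N"
proof
  assume "3 dvd N"
  define d where "d k = t (k + 1) - t k" for k
  have dne: "d k \<noteq> spiral_guess 0 (d k + d (k + 1))" for k
    using avoids[of k] spiral_guess_shift[of 0 "t k" "d k + d (k + 1)"]
    by (simp add: d_def algebra_simps)
  have zero_back: "d (Suc k) = 0 \<Longrightarrow> d k = 0" for k
    using dne[of k] by (auto simp: spiral_guess_def split: if_splits)
  have one_forth: "d k = 1 \<Longrightarrow> d (Suc k) = 1" for k
    using dne[of k] three_cases[of "d (Suc k)"] by (auto simp: spiral_guess_def split: if_splits)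
  have per1: "d (k + N) = d k" for k
    using twist[of k] twist[of "k + 1"] by (simp add: d_def algebra_simps)
  have per: "d (k + N * m) = d k" for k m
  proof (induction m)
    case (Suc m)
    then show ?case using per1[of "k + N * m"] by (simp add: algebra_simps)
  qed simp
  have "N \<noteq> 0" using twist[of 0] by (cases N) auto
  have "\<exists>c. \<forall>k. d k = c"
  proof (cases "\<exists>j. d j = 0 \<or> d j = 1")
    case True
    then obtain j where "d j = 0 \<or> d j = 1" by blast
    then show ?thesis
    proof
      assume "d j = 0"
      then have "d (j + N * k) = 0" for k using per by simp
      moreover have "d k = 0" if "d n = 0" "k \<le> n" for k n
        using that(2) by (induction k rule: inc_induct) (auto intro: zero_back that(1))
      moreover have "k \<le> j + N * k" for k using \<open>N \<noteq> 0\<close> by (cases N) auto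
      ultimately show ?thesis by blast
    next
      assume dj: "d j = 1"
      have "d k = 1" if "j \<le> k" for k
        using that by (induction k rule: dec_induct) (auto intro: one_forth dj)
      moreover have "j \<le> k + N * j" for k using \<open>N \<noteq> 0\<close> by (cases N) auto
      ultimately have "d (k + N * j) = 1" for k by blast
      then have "d k = 1" for k by (simp add: per)
      then show ?thesis by blast
    qed
  next
    case False
    then have "d k = 2" for k using three_cases[of "d k"] by blast
    then show ?thesis by blast
  qed
  then obtain c where c: "\<And>k. d k = c" by blast
  have walk: "t n = t 0 + of_nat n * c" for n
  proof (induction n)
    case (Suc n)
    have "t (Suc n) = t n + c" using c[of n] by (simp add: d_def algebra_simps)
    then show ?case using Suc by (simp add: algebra_simps)
  qed simp
  have "of_nat N = (0 :: 3)"
  proof -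
    obtain m where "N = 3 * m" using \<open>3 dvd N\<close> by (elim dvdE)
    moreover have "(3 :: 3) = 0" by simp
    ultimately show ?thesis by (simp only: of_nat_mult of_nat_numeral mult_zero_left)
  qed
  then have "t N = t 0" using walk[of N] by simp
  then show False using twist[of 0] by simp
qed

lemma wins_multiple_of_3:
  assumes "N \<ge> 3" "3 dvd N"
  shows "wins N (\<lambda>k x z. spiral_guess (if k = 0 then x - 1 else x) (if k = N - 1 then z + 1 else z))"
  unfolding wins_def
proof (rule allI, rule ccontr)
  fix s
  assume "\<not> (\<exists>k<N. s k = spiral_guess (if k = 0 then s (prev_player N k) - 1 else s (prev_player N k))
    (if k = N - 1 then s (next_player N k) + 1 else s (next_player N k)))"
  then have s: "s k \<noteq> spiral_guess (if k = 0 then s (prev_player N k) - 1 else s (prev_player N k))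
    (if k = N - 1 then s (next_player N k) + 1 else s (next_player N k))" if "k < N" for k
    using that by blast
  \<comment> \<open>Unrolling the colouring and adding 1 per turn absorbs the changes of colour at
    players \<open>0\<close> and \<open>N - 1\<close>.\<close>
  define t where "t k = s (k mod N) + of_nat (k div N)" for k
  have "t (k + 1) \<noteq> spiral_guess (t k) (t (k + 2))" for k
  proof -
    define j m where "j = (k + 1) mod N" and "m = (k + 1) div N"
    have jN: "j < N" and k1: "k + 1 = m * N + j" using assms(1) by (simp_all add: j_def m_def)
    have t: "t (i * N + r) = s r + of_nat i" if "r < N" for i r
      unfolding t_def using that by simp
    have 1: "t (k + 1) = s j + of_nat m" unfolding k1 by (rule t[OF jN])
    have 2: "t k = (if j = 0 then s (prev_player N j) - 1 else s (prev_player N j)) + of_nat m"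
    proof (cases "j = 0")
      case True
      then obtain m' where m': "m = Suc m'" using k1 by (cases m) auto
      then have "k = m' * N + (N - 1)" using k1 True assms(1) by simp
      then show ?thesis using t[of "N - 1" m'] True m' assms(1) by (simp add: prev_player_def)
    next
      case False
      then have "k = m * N + (j - 1)" "j + (N - 1) = (j - 1) + N" using k1 assms(1) by auto
      moreover from this(2) have "prev_player N j = j - 1"
        using jN unfolding prev_player_def by (simp only: mod_add_self2) simp
      ultimately show ?thesis using t[of "j - 1" m] False jN by simp
    qed
    have 3: "t (k + 2) = (if j = N - 1 then s (next_player N j) + 1 else s (next_player N j)) + of_nat m"
    proof (cases "j = N - 1")
      case True
      then have "k + 2 = Suc m * N + 0" using k1 assms(1) by simp
      then show ?thesis using t[of 0 "Suc m"] True assms(1) by (simp add: next_player_def)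
    next
      case False
      then have "k + 2 = m * N + (j + 1)" "j + 1 < N" using k1 jN by auto
      then show ?thesis using t[of "j + 1" m] False by (simp add: next_player_def)
    qed
    show ?thesis unfolding 1 2 3 spiral_guess_shift using s[OF jN] by simp
  qed
  moreover have "t (k + N) = t k + 1" for k
    unfolding t_def using assms(1) by (simp add: div_add_self2)
  ultimately show False using no_spiral assms(2) by blast
qed

section \<open>The strategy on the four-cycle\<close>

definition swap01 :: "3 \<Rightarrow> 3" where
  "swap01 x = (if x = 0 then 1 else if x = 1 then 0 else x)"

text \<open>The normal form with chains 0 and 1 and centre 2. The holonomy \<open>swap01\<close>
  exchanges the chains; as an involution it serves both directions across the edge between players 3
  and 0.\<close>

definition square_guess :: "3 \<Rightarrow> 3 \<Rightarrow> 3" where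
  "square_guess x z = (if x = z then 2 else if z = 2 then swap01 x else z)"

text \<open>A check of all 81 colourings.\<close>

lemma square_guess_covers:
  "a = square_guess (swap01 d) b \<or> b = square_guess a c \<or> c = square_guess b d
    \<or> d = square_guess c (swap01 a)"
proof -
  have ne: "(0::3) \<noteq> 1" "(1::3) \<noteq> 0" "(0::3) \<noteq> 2" "(2::3) \<noteq> 0" "(1::3) \<noteq> 2" "(2::3) \<noteq> 1" by simp_all
  have swap: "swap01 0 = 1" "swap01 1 = 0" "swap01 2 = 2" by (simp_all add: swap01_def)
  have square: "square_guess x x = 2" "square_guess 0 1 = 1" "square_guess 0 2 = 1"
    "square_guess 1 0 = 0" "square_guess 1 2 = 0" "square_guess 2 0 = 0" "square_guess 2 1 = 1" for x
    by (simp_all add: square_guess_def swap)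
  show ?thesis
    using three_cases[of a] three_cases[of b] three_cases[of c] three_cases[of d]
    by (elim disjE; simp only: square swap ne simp_thms)
qed

lemma wins_4:
  "wins 4 (\<lambda>k x z. square_guess (if k = 0 then swap01 x else x) (if k = 3 then swap01 z else z))"
  unfolding wins_def
proof
  fix s
  have ex: "\<exists>k<4. P k" if "P 0 \<or> P 1 \<or> P 2 \<or> P 3" for P :: "nat \<Rightarrow> bool"
    using that by (elim disjE) (rule exI, rule conjI[rotated], assumption, simp)+
  show "\<exists>k<4. s k = square_guess (if k = 0 then swap01 (s (prev_player 4 k)) else s (prev_player 4 k))
      (if k = 3 then swap01 (s (next_player 4 k)) else s (next_player 4 k))"
    by (rule ex) (simp add: prev_player_def next_player_def square_guess_covers flip: numeral_2_eq_2)
qed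

theorem theorem1:
  fixes N :: nat and V :: "nat \<Rightarrow> 'c set"
  assumes "N \<ge> 3"
    and "\<And>k. k \<in> players N \<Longrightarrow> card (V k) = 3"
  shows "(\<exists>f\<in>strategies N V. winning N V f) \<longleftrightarrow> 3 dvd N \<or> N = 4"
proof -
  have "(\<exists>f\<in>strategies N V. winning N V f) \<longleftrightarrow> (\<exists>G. wins N G)"
    by (rule winning_iff_wins) (use assms in auto)
  also have "\<dots> \<longleftrightarrow> 3 dvd N \<or> N = 4"
  proof
    assume "\<exists>G. wins N G"
    then show "3 dvd N \<or> N = 4" using wins_imp_length[OF assms(1)] by blast
  next
    assume "3 dvd N \<or> N = 4"
    then show "\<exists>G. wins N G"
    proof
      assume "3 dvd N"
      then show ?thesis using wins_multiple_of_3[OF assms(1)] by blast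
    next
      assume "N = 4"
      then show ?thesis using wins_4 by blast
    qed
  qed
  finally show ?thesis .
qed

end
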